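(* Let $n\ge2$, $N=\{1,\dots,n\}$, let $\mathcal{X}\subseteq\mathbb{Z}^n$ be a discrete hyperrectangle, and let $h^i:\mathcal{X}\to\mathbb{R}$, $i\in N$, be such that $h^j$ and $g^j_i(\mathbf{x})=\max\{0,h^i(\mathbf{x})-h^j(\mathbf{x})\}$ are L$^\natural$-convex for all $i,j\in N$ and $F_{u_0,\mathbf{u}}$ is L$^\natural$-convex for every $(u_0,\mathbf{u})\in\mathcal{U}$. Let $\mathcal{P}^H=\{(w,\mathbf{y},\mathbf{x})\in\mathbb{R}\times\mathbb{R}^n_+\times\mathcal{X}:w\ge h^i(\mathbf{x})-y_i\ \forall i\in N\}$. Fix $\mathbf{p}\in\underline{\mathcal{X}}$ with $\mathcal{B}_{\mathbf{p}}\subseteq\mathcal{X}$ and a permutation $\boldsymbol\delta$ of $N$. For $k\in N\cup\{0\}$ put $\mathbf{p}^k=\mathbf{p}+\sum_{j=1}^k\mathbf{1}^{\delta(j)}$ and $h^k_i=h^i(\mathbf{p}^k)$, and suppose that for every $k\in N\cup\{0\}$ the numbers $\{h^k_i\}_{i\in N}$ are all distinct; write $h^k_{(1)^k}>h^k_{(2)^k}>\dots>h^k_{(n)^k}$. Pick any $\ell_k\in N$ for each $k\in N\cup\{0\}$, and let $A(\boldsymbol\ell)\in\{0,1\}^{(n+1)\times n}$ (rows indexed by $N\cup\{0\}$, columns by $N$) have entries $A(\boldsymbol\ell)_{k,(j)^k}=1$ if $j\le\ell_k$ and $0$ otherwise. Let $M\subseteq N$ be the set of indices of nonzero columns of $A(\boldsymbol\ell)$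 and $m=|M|$. Suppose $A(\boldsymbol\ell)$ contains an $m\times m$ submatrix $B$ that is invertible and satisfies $B^{-1}\mathbf{1}>\mathbf{0}$ entry-wise. Define $\mathbf{u}\in\mathbb{R}^n_+$ by $\mathbf{u}^M=B^{-1}\mathbf{1}$ and $\mathbf{u}^{N\setminus M}=\mathbf{0}$. Then the MISEPI associated with $\mathbf{p}$, $\boldsymbol\delta$ and $(1,\mathbf{u})$, $$w+\mathbf{u}^\top\mathbf{y}\ \ge\ F_{1,\mathbf{u}}(\mathbf{p}^0)+\sum_{i=1}^n\big[F_{1,\mathbf{u}}(\mathbf{p}^i)-F_{1,\mathbf{u}}(\mathbf{p}^{i-1})\big](x_{\delta(i)}-p_{\delta(i)}),$$ is facet-defining for $\operatorname{conv}(\mathcal{P}^H)$.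
   Context: A discrete hyperrectangle is $\mathcal{X}=\{\mathbf{x}\in\mathbb{Z}^n:a_i\le x_i\le b_i\ \forall i\in N\}$ with $a_i\in\mathbb{Z}\cup\{-\infty\}$, $b_i\in\mathbb{Z}\cup\{+\infty\}$; $\underline{\mathcal{X}}=\{\mathbf{x}\in\mathbb{Z}^n:a_i\le x_i\le b_i-1\ \forall i\}$; $\mathcal{B}_{\mathbf{p}}=\{\mathbf{x}\in\mathbb{Z}^n:p_i\le x_i\le p_i+1\ \forall i\}$. $f:\mathcal{X}\to\mathbb{R}$ is L$^\natural$-convex if $f(\mathbf{x})+f(\mathbf{y})\ge f(\lceil(\mathbf{x}+\mathbf{y})/2\rceil)+f(\lfloor(\mathbf{x}+\mathbf{y})/2\rfloor)$ for all $\mathbf{x},\mathbf{y}\in\mathcal{X}$ (component-wise rounding). $\mathcal{U}=\{(u_0,\mathbf{u})\in\mathbb{R}^{n+1}_+:u_0\le\sum_{i\in N}u_i\}$ and $F_{u_0,\mathbf{u}}(\mathbf{x})=\min_{j\in N}\{u_0h^j(\mathbf{x})+\sum_{i\in N}u_ig^j_i(\mathbf{x})\}$. $\mathbf{1}^i$ is the $i$-th unit vector, $\mathbf{1}$ the all-ones vector, and $\mathbf{u}^M=[u_i]_{i\in M}$. Invertibility and inverses of matrices are over $\mathbb{R}$; a nonsingular $m\times m$ submatrix of $A(\boldsymbol\ell)$ necessarily has column set $M$, and the entries of $B^{-1}\mathbf{1}$ are indexed by these columns. An inequality is facet-defining for the full-dimensional convex set $\operatorname{conv}(\mathcal{P}^H)\subseteq\mathbb{R}^{2n+1}$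 if it is valid for it and holds with equality at $2n+1$ affinely independent points of it, but not everywhere on it. *)

theory Defs
  imports "HOL-Analysis.Analysis" "HOL-Library.Extended"
begin

text \<open>The index set $N$ is the universe of a finite type \<open>'n\<close>, so $n$ is \<open>CARD('n)\<close>. Functions on
  a hyperrectangle are total functions on \<open>int ^ 'n\<close>; only their values on the hyperrectangle
  are ever constrained or used.\<close>

definition hyperrect :: "('n \<Rightarrow> int extended) \<Rightarrow> ('n \<Rightarrow> int extended) \<Rightarrow> (int ^ 'n) set" where
  "hyperrect a b = {x. \<forall>i. a i \<le> Fin (x $ i) \<and> Fin (x $ i) \<le> b i}"

definition hyperrect_under :: "('n \<Rightarrow> int extended) \<Rightarrow> ('n \<Rightarrow> int extended) \<Rightarrow> (int ^ 'n) set" where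
  "hyperrect_under a b = {x. \<forall>i. a i \<le> Fin (x $ i) \<and> Fin (x $ i) \<le> b i - 1}"

definition unit_box :: "int ^ 'n \<Rightarrow> (int ^ 'n) set" where
  "unit_box p = {x. \<forall>i. p $ i \<le> x $ i \<and> x $ i \<le> p $ i + 1}"

definition mid_ceil :: "int ^ 'n \<Rightarrow> int ^ 'n \<Rightarrow> int ^ 'n" where
  "mid_ceil x y = (\<chi> i. \<lceil>real_of_int (x $ i + y $ i) / 2\<rceil>)"

definition mid_floor :: "int ^ 'n \<Rightarrow> int ^ 'n \<Rightarrow> int ^ 'n" where
  "mid_floor x y = (\<chi> i. \<lfloor>real_of_int (x $ i + y $ i) / 2\<rfloor>)"

text \<open>On a hyperrectangle the two rounded midpoints lie in the set again, so no value of
  \<open>f\<close> outside \<open>X\<close> is used.\<close>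

definition Lnat_convex_on :: "(int ^ 'n) set \<Rightarrow> (int ^ 'n \<Rightarrow> real) \<Rightarrow> bool" where
  "Lnat_convex_on X f \<longleftrightarrow>
     (\<forall>x\<in>X. \<forall>y\<in>X. f x + f y \<ge> f (mid_ceil x y) + f (mid_floor x y))"

definition g_fun :: "('n \<Rightarrow> int ^ 'n \<Rightarrow> real) \<Rightarrow> 'n \<Rightarrow> 'n \<Rightarrow> int ^ 'n \<Rightarrow> real" where
  "g_fun h j i x = max 0 (h i x - h j x)"

definition U_set :: "(real \<times> (real ^ 'n)) set" where
  "U_set = {(u0, u). 0 \<le> u0 \<and> (\<forall>i. 0 \<le> u $ i) \<and> u0 \<le> (\<Sum>i\<in>UNIV. u $ i)}"

definition F_fun ::
  "('n::finite \<Rightarrow> int ^ 'n \<Rightarrow> real) \<Rightarrow> real \<Rightarrow> real ^ 'n \<Rightarrow> int ^ 'n \<Rightarrow> real" where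
  "F_fun h u0 u x = (MIN j. u0 * h j x + (\<Sum>i\<in>UNIV. u $ i * g_fun h j i x))"

definition real_vec :: "int ^ 'n \<Rightarrow> real ^ 'n" where
  "real_vec x = (\<chi> i. real_of_int (x $ i))"

definition P_H ::
  "(int ^ 'n) set \<Rightarrow> ('n \<Rightarrow> int ^ 'n \<Rightarrow> real) \<Rightarrow> (real \<times> (real ^ 'n) \<times> (real ^ 'n)) set" where
  "P_H X h = {(w, y, real_vec x) | w y x.
     x \<in> X \<and> (\<forall>i. 0 \<le> y $ i) \<and> (\<forall>i. w \<ge> h i x - y $ i)}"

text \<open>A permutation $\delta$ of $N$ is a bijection from \<open>{1..CARD('n)}\<close> onto \<open>'n\<close>.\<close>

definition chain_pt :: "int ^ 'n \<Rightarrow> (nat \<Rightarrow> 'n) \<Rightarrow> nat \<Rightarrow> int ^ 'n" where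
  "chain_pt p \<delta> k = p + (\<Sum>j=1..k. axis (\<delta> j) 1)"

definition misepi_rhs ::
  "('n::finite \<Rightarrow> int ^ 'n \<Rightarrow> real) \<Rightarrow> int ^ 'n \<Rightarrow> (nat \<Rightarrow> 'n) \<Rightarrow> real \<Rightarrow> real ^ 'n \<Rightarrow> real ^ 'n \<Rightarrow> real"
  where
  "misepi_rhs h p \<delta> u0 u x = F_fun h u0 u (chain_pt p \<delta> 0) +
     (\<Sum>i=1..CARD('n). (F_fun h u0 u (chain_pt p \<delta> i) - F_fun h u0 u (chain_pt p \<delta> (i - 1)))
        * (x $ \<delta> i - real_of_int (p $ \<delta> i)))"

text \<open>A matrix with finite row index set \<open>R\<close> and column index set \<open>C\<close> is the restriction of a
  function \<open>B\<close> to \<open>R \<times> C\<close>; a submatrix of a given matrix is then the same function on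
  smaller index sets. The inverse is indexed by \<open>C \<times> R\<close> and, as for \<^const>\<open>matrix_inv\<close>, picked by
  choice; it is unique on \<open>C \<times> R\<close>.\<close>

definition inverse_pair_on ::
  "'r set \<Rightarrow> 'c set \<Rightarrow> ('r \<Rightarrow> 'c \<Rightarrow> real) \<Rightarrow> ('c \<Rightarrow> 'r \<Rightarrow> real) \<Rightarrow> bool" where
  "inverse_pair_on R C B D \<longleftrightarrow>
     (\<forall>r\<in>R. \<forall>r'\<in>R. (\<Sum>c\<in>C. B r c * D c r') = (if r = r' then 1 else 0)) \<and>
     (\<forall>c\<in>C. \<forall>c'\<in>C. (\<Sum>r\<in>R. D c r * B r c') = (if c = c' then 1 else 0))"

definition invertible_on :: "'r set \<Rightarrow> 'c set \<Rightarrow> ('r \<Rightarrow> 'c \<Rightarrow> real) \<Rightarrow> bool" where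
  "invertible_on R C B \<longleftrightarrow> (\<exists>D. inverse_pair_on R C B D)"

definition matrix_inv_on ::
  "'r set \<Rightarrow> 'c set \<Rightarrow> ('r \<Rightarrow> 'c \<Rightarrow> real) \<Rightarrow> 'c \<Rightarrow> 'r \<Rightarrow> real" where
  "matrix_inv_on R C B = (SOME D. inverse_pair_on R C B D)"

text \<open>The inequality \<open>lhs z \<ge> rhs z\<close> (for affine \<open>lhs\<close> and \<open>rhs\<close>) defines a facet of the
  full-dimensional convex set \<open>S\<close>. Full-dimensionality of \<open>S\<close> need not be required separately:
  the \<open>DIM('a)\<close> affinely independent points together with a point of \<open>S\<close> off the hyperplane imply it.\<close>

definition facet_defining ::
  "('a::euclidean_space \<Rightarrow> real) \<Rightarrow> ('a \<Rightarrow> real) \<Rightarrow> 'a set \<Rightarrow> bool" where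
  "facet_defining lhs rhs S \<longleftrightarrow>
     (\<forall>z\<in>S. lhs z \<ge> rhs z) \<and>
     (\<exists>T\<subseteq>S. card T = DIM('a) \<and> \<not> affine_dependent T \<and> (\<forall>z\<in>T. lhs z = rhs z)) \<and>
     (\<exists>z\<in>S. lhs z \<noteq> rhs z)"

end

theory Submission
  imports Defs
begin

text \<open>Validity rests on two estimates. Minimising \<open>w + u \<bullet> y\<close> over the admissible \<open>y\<close> leaves a convex
  piecewise linear function of \<open>w\<close> whose minimum is \<open>F x\<close>, where \<open>F\<close> is \<open>F_fun h 1 u\<close>. And an
  L-natural-convex \<open>F\<close> lies above its affine interpolant along the chain on all of \<open>X\<close>: subtract the
  interpolant to get an L-natural-convex \<open>G\<close> that vanishes on the chain; inside the unit box midpoint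
  convexity with a chain point lowers the last raised coordinate, and outside the box midpoints with
  \<open>p\<close> or \<open>p + 1\<close> move strictly towards it, so \<open>G \<ge> 0\<close> by induction.

  For the facet, a row \<open>k\<close> of \<open>B\<close> says that the slope in \<open>w\<close> is \<open>0\<close> between two consecutive
  breakpoints at the chain point number \<open>k\<close>. This yields the tight directions \<open>(1, - A k, 0)\<close>.
  Together with \<open>(0, axis i 1, 0)\<close> for \<open>u $ i = 0\<close>, with differences of tight points over
  consecutive chain points, and with the one transversal direction \<open>(1, 0, 0)\<close>, they span the whole
  space because \<open>B\<close> is invertible.\<close>

section \<open>Rounded midpoints in integer arithmetic\<close>

lemma ceil_half_int: "\<lceil>real_of_int s / 2\<rceil> = (s + 1) div 2"
  by linarith

lemma floor_half_int: "\<lfloor>real_of_int s / 2\<rfloor> = s div 2"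
  by linarith

lemma mid_ceil_nth: "mid_ceil x y $ i = (x $ i + y $ i + 1) div 2"
  by (simp add: mid_ceil_def ceil_half_int del: of_int_add)

lemma mid_floor_nth: "mid_floor x y $ i = (x $ i + y $ i) div 2"
  by (simp add: mid_floor_def floor_half_int del: of_int_add)

lemma mid_ceil_plus_mid_floor: "mid_ceil x y $ i + mid_floor x y $ i = x $ i + y $ i"
  unfolding mid_ceil_nth mid_floor_nth by presburger

text \<open>Both rounded midpoints lie coordinatewise between their two arguments, so this one fact
  covers them; an infinite bound constrains nothing.\<close>

lemma hyperrect_between:
  assumes "x \<in> hyperrect a b" "y \<in> hyperrect a b"
    and "\<And>i. min (x $ i) (y $ i) \<le> z $ i \<and> z $ i \<le> max (x $ i) (y $ i)"
  shows "z \<in> hyperrect a b"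
  unfolding hyperrect_def
proof (clarify, intro conjI)
  fix i
  have "a i \<le> Fin (x $ i)" "a i \<le> Fin (y $ i)" "Fin (x $ i) \<le> b i" "Fin (y $ i) \<le> b i"
    using assms(1,2) by (auto simp: hyperrect_def)
  then show "a i \<le> Fin (z $ i)" "Fin (z $ i) \<le> b i"
    using assms(3)[of i] by (cases "a i"; cases "b i"; auto)+
qed

lemma hyperrect_mid:
  assumes "x \<in> hyperrect a b" "y \<in> hyperrect a b"
  shows "mid_ceil x y \<in> hyperrect a b" "mid_floor x y \<in> hyperrect a b"
proof -
  show "mid_ceil x y \<in> hyperrect a b"
    by (rule hyperrect_between[OF assms]) (unfold mid_ceil_nth, linarith)
  show "mid_floor x y \<in> hyperrect a b"
    by (rule hyperrect_between[OF assms]) (unfold mid_floor_nth, linarith)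
qed

section \<open>The chain and its affine interpolant\<close>

lemma chain_pt_nth:
  fixes \<delta> :: "nat \<Rightarrow> 'n::finite"
  assumes perm: "bij_betw \<delta> {1..CARD('n)} UNIV" and i: "i \<in> {1..CARD('n)}" and k: "k \<le> CARD('n)"
  shows "chain_pt p \<delta> k $ \<delta> i = p $ \<delta> i + (if i \<le> k then 1 else 0)"
proof -
  have "(\<Sum>j=1..k. axis (\<delta> j) (1::int) $ \<delta> i) = (\<Sum>j=1..k. if j = i then 1 else 0)"
  proof (rule sum.cong[OF refl])
    fix j assume "j \<in> {1..k}"
    then have "\<delta> i = \<delta> j \<longleftrightarrow> i = j"
      using inj_on_eq_iff[OF bij_betw_imp_inj_on[OF perm] i, of j] k by simp
    then show "axis (\<delta> j) (1::int) $ \<delta> i = (if j = i then 1 else 0)"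
      unfolding axis_def vec_lambda_beta by presburger
  qed
  also have "\<dots> = (if i \<le> k then 1 else 0)"
    using i by simp
  finally show ?thesis
    by (simp add: chain_pt_def)
qed

lemma chain_pt_in_unit_box:
  fixes \<delta> :: "nat \<Rightarrow> 'n::finite"
  assumes perm: "bij_betw \<delta> {1..CARD('n)} UNIV" and k: "k \<le> CARD('n)"
  shows "chain_pt p \<delta> k \<in> unit_box p"
  unfolding unit_box_def
proof (clarify, goal_cases)
  case (1 i)
  obtain j where "j \<in> {1..CARD('n)}" "i = \<delta> j"
    using perm by (metis UNIV_I bij_betw_iff_bijections)
  then show ?case
    using chain_pt_nth[OF perm _ k, of j p] by auto
qed

text \<open>The affine function through the values of \<open>F\<close> at the \<open>n + 1\<close>
  vertices of the simplex spanned by the chain; there it is the Lovasz extension. \<open>F\<close>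
  is kept arbitrary because only its L-natural-convexity matters for the lower bound.\<close>

definition chain_interp ::
  "int ^ 'n \<Rightarrow> (nat \<Rightarrow> 'n) \<Rightarrow> (int ^ 'n \<Rightarrow> real) \<Rightarrow> real ^ 'n::finite \<Rightarrow> real" where
  "chain_interp p \<delta> F x = F (chain_pt p \<delta> 0) +
     (\<Sum>i=1..CARD('n). (F (chain_pt p \<delta> i) - F (chain_pt p \<delta> (i - 1)))
        * (x $ \<delta> i - real_of_int (p $ \<delta> i)))"

lemma misepi_rhs_eq_chain_interp: "misepi_rhs h p \<delta> u0 u = chain_interp p \<delta> (F_fun h u0 u)"
  by (simp add: misepi_rhs_def chain_interp_def fun_eq_iff)

lemma chain_interp_chain_pt:
  fixes \<delta> :: "nat \<Rightarrow> 'n::finite"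
  assumes perm: "bij_betw \<delta> {1..CARD('n)} UNIV" and k: "k \<le> CARD('n)"
  shows "chain_interp p \<delta> F (real_vec (chain_pt p \<delta> k)) = F (chain_pt p \<delta> k)"
proof -
  let ?d = "\<lambda>i. F (chain_pt p \<delta> i) - F (chain_pt p \<delta> (i - 1))"
  have "(\<Sum>i=1..CARD('n). ?d i * (real_vec (chain_pt p \<delta> k) $ \<delta> i - real_of_int (p $ \<delta> i)))
      = (\<Sum>i=1..CARD('n). if i \<le> k then ?d i else 0)"
    by (intro sum.cong) (auto simp: real_vec_def chain_pt_nth[OF perm _ k])
  also have "\<dots> = (\<Sum>i=1..k. ?d i)"
    using k by (intro sum.mono_neutral_cong_right) auto
  also have "\<dots> = F (chain_pt p \<delta> k) - F (chain_pt p \<delta> 0)"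
    by (induction k) auto
  finally show ?thesis
    by (simp add: chain_interp_def)
qed

lemma chain_interp_affine:
  fixes x y :: "real ^ 'n::finite"
  assumes "s + t = 1"
  shows "chain_interp p \<delta> F (s *\<^sub>R x + t *\<^sub>R y) = s * chain_interp p \<delta> F x + t * chain_interp p \<delta> F y"
proof -
  have t: "t = 1 - s"
    using assms by simp
  have "d * ((s *\<^sub>R x + t *\<^sub>R y) $ i - q) = s * (d * (x $ i - q)) + t * (d * (y $ i - q))" for d q i
    by (simp add: t algebra_simps)
  then show ?thesis
    by (simp add: chain_interp_def sum.distrib distrib_left t flip: sum_distrib_left)
      (simp add: algebra_simps)
qed

section \<open>L-natural-convex functions lie above the interpolant\<close>

lemma nonneg_on_unit_box:
  fixes \<delta> :: "nat \<Rightarrow> 'n::finite"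
  assumes perm: "bij_betw \<delta> {1..CARD('n)} UNIV"
    and G: "Lnat_convex_on (unit_box p) G"
    and zero: "\<And>k. k \<le> CARD('n) \<Longrightarrow> G (chain_pt p \<delta> k) = 0"
    and x: "x \<in> unit_box p"
  shows "G x \<ge> 0"
proof -
  have coord: "\<exists>j\<in>{1..CARD('n)}. i = \<delta> j" for i
    using perm by (metis UNIV_I bij_betw_iff_bijections)
  \<comment> \<open>Here \<open>k\<close> bounds the positions, in the order of
    \<open>\<delta>\<close>, at which \<open>x\<close> exceeds \<open>p\<close>.\<close>
  have "G x \<ge> 0" if "k \<le> CARD('n)" "x \<in> unit_box p" "\<And>j. j \<in> {k<..CARD('n)} \<Longrightarrow> x $ \<delta> j = p $ \<delta> j" for k x
    using that
  proof (induction k arbitrary: x)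
    case 0
    have "x $ i = p $ i" for i
      using coord[of i] 0(3) by auto
    then have "x = chain_pt p \<delta> 0"
      by (simp add: vec_eq_iff chain_pt_def)
    then show ?case
      using zero by simp
  next
    case (Suc k)
    let ?c = "chain_pt p \<delta> k"
    have k: "k \<le> CARD('n)" "Suc k \<in> {1..CARD('n)}"
      using Suc.prems by auto
    have xb: "p $ i \<le> x $ i \<and> x $ i \<le> p $ i + 1" for i
      using Suc.prems(2) by (auto simp: unit_box_def)
    consider "x $ \<delta> (Suc k) = p $ \<delta> (Suc k)" | "x $ \<delta> (Suc k) = p $ \<delta> (Suc k) + 1"
      using xb[of "\<delta> (Suc k)"] by linarith
    then show ?case
    proof cases
      case 1
      have "x $ \<delta> j = p $ \<delta> j" if "j \<in> {k<..CARD('n)}" for j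
        using Suc.prems(3)[of j] 1 that by (cases "j = Suc k") auto
      then show ?thesis
        using Suc.IH[of x] k Suc.prems(2) by blast
    next
      case 2
      \<comment> \<open>Rounding up fills the first \<open>k\<close> positions and keeps the raised
        position \<open>Suc k\<close>, which gives a zero of \<open>G\<close>; rounding down only
        clears position \<open>Suc k\<close>, so the induction hypothesis applies to it.\<close>
      have up: "mid_ceil x ?c = chain_pt p \<delta> (Suc k)"
        unfolding vec_eq_iff
      proof
        fix i
        obtain j where j: "j \<in> {1..CARD('n)}" "i = \<delta> j"
          using coord by blast
        have "x $ \<delta> j = p $ \<delta> j" if "j > Suc k"
          using Suc.prems(3)[of j] that j by auto
        moreover have "x $ \<delta> j = p $ \<delta> j + 1" if "j = Suc k"
          using that 2 by simp
        ultimately show "mid_ceil x ?c $ i = chain_pt p \<delta> (Suc k) $ i"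
          using xb[of i] j chain_pt_nth[OF perm j(1) k(1), of p]
            chain_pt_nth[OF perm j(1) Suc.prems(1), of p]
          by (cases j "Suc k" rule: linorder_cases) (auto simp: mid_ceil_nth)
      qed
      have c: "?c \<in> unit_box p"
        by (rule chain_pt_in_unit_box[OF perm k(1)])
      then have cb: "p $ i \<le> ?c $ i \<and> ?c $ i \<le> p $ i + 1" for i
        by (auto simp: unit_box_def)
      have "mid_floor x ?c \<in> unit_box p"
        unfolding unit_box_def
      proof (clarify, goal_cases)
        case (1 i)
        show ?case
          using xb[of i] cb[of i] unfolding mid_floor_nth by linarith
      qed
      moreover have "mid_floor x ?c $ \<delta> j = p $ \<delta> j" if j: "j \<in> {k<..CARD('n)}" for j
        using xb[of "\<delta> j"] chain_pt_nth[OF perm _ k(1), of j p] j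
        by (auto simp: mid_floor_nth)
      ultimately have "G (mid_floor x ?c) \<ge> 0"
        using Suc.IH k by blast
      moreover have "G x + G ?c \<ge> G (mid_ceil x ?c) + G (mid_floor x ?c)"
        using G Suc.prems(2) c by (auto simp: Lnat_convex_on_def)
      ultimately show ?thesis
        using zero[OF k(1)] zero[OF Suc.prems(1)] up by simp
    qed
  qed
  from this[of "CARD('n)" x] x show ?thesis
    by simp
qed

text \<open>With \<open>t = x $ i - p $ i\<close>, the absolute value is twice the distance to the
  centre of the unit box in one coordinate. The shift \<open>s\<close> encodes the corner and the
  rounding: 0 and 1 for \<open>p\<close>, 1 and 2 for \<open>p + 1\<close>.\<close>

lemma halve_abs_le:
  fixes t s :: int
  assumes "s = 0 \<or> s = 1 \<or> s = 2 \<and> t \<le> 1"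
  shows "\<bar>2 * ((t + s) div 2) - 1\<bar> \<le> \<bar>2 * t - 1\<bar>"
proof -
  obtain q where "t = 2 * q \<or> t = 2 * q + 1"
    by (metis evenE oddE)
  then show ?thesis
    using assms by (auto; presburger)
qed

text \<open>The corner on the far side is essential for strictness: \<open>t = 2\<close> with
  \<open>s = 2\<close> and \<open>t = -1\<close> with \<open>s = 0\<close> are fixed points of the
  halving.\<close>

lemma halve_abs_less:
  fixes t s :: int
  assumes "t \<ge> 2 \<and> s \<in> {0, 1} \<or> t < 0 \<and> s \<in> {1, 2}"
  shows "\<bar>2 * ((t + s) div 2) - 1\<bar> < \<bar>2 * t - 1\<bar>"
proof -
  obtain q where "t = 2 * q \<or> t = 2 * q + 1"
    by (metis evenE oddE)
  then show ?thesis
    using assms by (auto; presburger)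
qed

lemma nonneg_on_hyperrect:
  fixes \<delta> :: "nat \<Rightarrow> 'n::finite"
  assumes perm: "bij_betw \<delta> {1..CARD('n)} UNIV" and box: "unit_box p \<subseteq> hyperrect a b"
    and G: "Lnat_convex_on (hyperrect a b) G"
    and zero: "\<And>k. k \<le> CARD('n) \<Longrightarrow> G (chain_pt p \<delta> k) = 0"
    and x: "x \<in> hyperrect a b"
  shows "G x \<ge> 0"
  using x
\<comment> \<open>The measure is twice the l1-distance to the centre of the unit box; doubling keeps
  it integral.\<close>
proof (induction "\<Sum>i\<in>UNIV. nat \<bar>2 * (x $ i - p $ i) - 1\<bar>" arbitrary: x rule: less_induct)
  case less
  let ?d = "\<lambda>x i. nat \<bar>2 * (x $ i - p $ i) - 1\<bar>"
  have step: "G x \<ge> 0"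
    if y: "y = chain_pt p \<delta> k" "k \<le> CARD('n)"
      and le: "\<And>i. ?d (mid_ceil x y) i \<le> ?d x i" "\<And>i. ?d (mid_floor x y) i \<le> ?d x i"
      and lt: "?d (mid_ceil x y) i < ?d x i" "?d (mid_floor x y) i < ?d x i" for y k i
  proof -
    have yX: "y \<in> hyperrect a b"
      using chain_pt_in_unit_box[OF perm y(2)] box y(1) by blast
    have "sum (?d (mid_ceil x y)) UNIV < sum (?d x) UNIV" "sum (?d (mid_floor x y)) UNIV < sum (?d x) UNIV"
      using le lt by (auto intro!: sum_strict_mono_ex1)
    then have "G (mid_ceil x y) \<ge> 0" "G (mid_floor x y) \<ge> 0"
      using less.hyps hyperrect_mid[OF less.prems yX] by blast+
    moreover have "G x + G y \<ge> G (mid_ceil x y) + G (mid_floor x y)"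
      using G less.prems yX by (auto simp: Lnat_convex_on_def)
    ultimately show ?thesis
      using zero[OF y(2)] y(1) by simp
  qed
  have top: "mid_ceil x (chain_pt p \<delta> CARD('n)) $ i - p $ i = (x $ i - p $ i + 2) div 2"
    "mid_floor x (chain_pt p \<delta> CARD('n)) $ i - p $ i = (x $ i - p $ i + 1) div 2" for i
  proof -
    obtain j where "j \<in> {1..CARD('n)}" "i = \<delta> j"
      using perm by (metis UNIV_I bij_betw_iff_bijections)
    then have "chain_pt p \<delta> CARD('n) $ i = p $ i + 1"
      using chain_pt_nth[OF perm, of j "CARD('n)" p] by auto
    then show "mid_ceil x (chain_pt p \<delta> CARD('n)) $ i - p $ i = (x $ i - p $ i + 2) div 2"
      "mid_floor x (chain_pt p \<delta> CARD('n)) $ i - p $ i = (x $ i - p $ i + 1) div 2"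
      unfolding mid_ceil_nth mid_floor_nth by linarith+
  qed
  \<comment> \<open>The summand \<open>+ 0\<close> below keeps the shape
    \<open>(t + s) div 2\<close> of the halving lemmas.\<close>
  have bot: "mid_ceil x (chain_pt p \<delta> 0) $ i - p $ i = (x $ i - p $ i + 1) div 2"
    "mid_floor x (chain_pt p \<delta> 0) $ i - p $ i = (x $ i - p $ i + 0) div 2" for i
  proof -
    have "chain_pt p \<delta> 0 $ i = p $ i"
      by (simp add: chain_pt_def)
    then show "mid_ceil x (chain_pt p \<delta> 0) $ i - p $ i = (x $ i - p $ i + 1) div 2"
      "mid_floor x (chain_pt p \<delta> 0) $ i - p $ i = (x $ i - p $ i + 0) div 2"
      unfolding mid_ceil_nth mid_floor_nth by linarith+
  qed
  \<comment> \<open>A coordinate above the box calls for the corner \<open>p\<close>; if there is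
    none, a coordinate below the box calls for \<open>p + 1\<close>.\<close>
  consider (hi) i where "x $ i \<ge> p $ i + 2" | (lo) i where "\<And>j. x $ j \<le> p $ j + 1" "x $ i < p $ i"
    | (mid) "x \<in> unit_box p"
    unfolding unit_box_def mem_Collect_eq by (smt (verit))
  then show ?case
  proof cases
    case (hi i)
    show ?thesis
    proof (rule step[OF refl le0, of i])
      show "?d (mid_ceil x (chain_pt p \<delta> 0)) j \<le> ?d x j"
        "?d (mid_floor x (chain_pt p \<delta> 0)) j \<le> ?d x j" for j
        unfolding bot by (intro nat_mono halve_abs_le; simp)+
      show "?d (mid_ceil x (chain_pt p \<delta> 0)) i < ?d x i"
        "?d (mid_floor x (chain_pt p \<delta> 0)) i < ?d x i"
        unfolding bot using hi halve_abs_less[of "x $ i - p $ i" 1] halve_abs_less[of "x $ i - p $ i" 0]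
        by simp_all
    qed
  next
    case (lo i)
    show ?thesis
    proof (rule step[OF refl order_refl, of i])
      show "?d (mid_ceil x (chain_pt p \<delta> CARD('n))) j \<le> ?d x j"
        "?d (mid_floor x (chain_pt p \<delta> CARD('n))) j \<le> ?d x j" for j
        unfolding top using lo(1)[of j] by (intro nat_mono halve_abs_le; simp)+
      show "?d (mid_ceil x (chain_pt p \<delta> CARD('n))) i < ?d x i"
        "?d (mid_floor x (chain_pt p \<delta> CARD('n))) i < ?d x i"
        unfolding top using lo(2) halve_abs_less[of "x $ i - p $ i" 2] halve_abs_less[of "x $ i - p $ i" 1]
        by simp_all
    qed
  next
    case mid
    have "Lnat_convex_on (unit_box p) G"
      using G box by (auto simp: Lnat_convex_on_def)
    then show ?thesis
      by (rule nonneg_on_unit_box[OF perm]) (fact zero, fact mid)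
  qed
qed

lemma Lnat_convex_on_ge_chain_interp:
  fixes \<delta> :: "nat \<Rightarrow> 'n::finite"
  assumes perm: "bij_betw \<delta> {1..CARD('n)} UNIV" and box: "unit_box p \<subseteq> hyperrect a b"
    and F: "Lnat_convex_on (hyperrect a b) F" and x: "x \<in> hyperrect a b"
  shows "F x \<ge> chain_interp p \<delta> F (real_vec x)"
proof -
  let ?G = "\<lambda>x. F x - chain_interp p \<delta> F (real_vec x)"
  \<comment> \<open>Since rounding preserves the sum, an affine function contributes equally to both
    sides of the convexity inequality and can be subtracted.\<close>
  have mid: "real_vec x + real_vec y = real_vec (mid_ceil x y) + real_vec (mid_floor x y)"
    for x y :: "int ^ 'n"
    by (simp only: vec_eq_iff real_vec_def vector_add_component vec_lambda_beta flip: of_int_add)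
      (simp add: mid_ceil_plus_mid_floor)
  have "Lnat_convex_on (hyperrect a b) ?G"
    unfolding Lnat_convex_on_def
  proof (intro ballI)
    fix x y assume "x \<in> hyperrect a b" "y \<in> hyperrect a b"
    then have "F x + F y \<ge> F (mid_ceil x y) + F (mid_floor x y)"
      using F by (auto simp: Lnat_convex_on_def)
    moreover have "chain_interp p \<delta> F ((1/2) *\<^sub>R real_vec x + (1/2) *\<^sub>R real_vec y) =
        chain_interp p \<delta> F ((1/2) *\<^sub>R real_vec (mid_ceil x y) + (1/2) *\<^sub>R real_vec (mid_floor x y))"
      by (simp only: mid[of x y] flip: scaleR_add_right)
    then have "chain_interp p \<delta> F (real_vec x) + chain_interp p \<delta> F (real_vec y) =
        chain_interp p \<delta> F (real_vec (mid_ceil x y)) + chain_interp p \<delta> F (real_vec (mid_floor x y))"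
      by (simp add: chain_interp_affine)
    ultimately show "?G x + ?G y \<ge> ?G (mid_ceil x y) + ?G (mid_floor x y)"
      by linarith
  qed
  then have "?G x \<ge> 0"
    by (rule nonneg_on_hyperrect[OF perm box _ _ x]) (simp add: chain_interp_chain_pt[OF perm])
  then show ?thesis by simp
qed

section \<open>\<open>F_fun\<close> as the minimum of a piecewise linear function of one
  variable\<close>

text \<open>Ties at \<open>c\<close> may fall on either side of \<open>P\<close>. Hence one
  \<open>P\<close> serves a whole closed interval between breakpoints, where the sum is linear in
  \<open>c\<close>.\<close>

lemma sum_pos_part_eq:
  fixes u :: "real ^ 'n::finite"
  assumes "\<And>i. i \<in> P \<Longrightarrow> c \<le> f i" "\<And>i. i \<notin> P \<Longrightarrow> f i \<le> c"
  shows "(\<Sum>i\<in>UNIV. u $ i * max 0 (f i - c)) = (\<Sum>i\<in>P. u $ i * f i) - c * (\<Sum>i\<in>P. u $ i)"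
proof -
  have "(\<Sum>i\<in>UNIV. u $ i * max 0 (f i - c)) = (\<Sum>i\<in>P. u $ i * (f i - c))"
    using assms by (intro sum.mono_neutral_cong_right) (auto simp: max_def intro: antisym)
  then show ?thesis
    by (simp add: right_diff_distrib sum_subtractf sum_distrib_left mult.commute)
qed

lemma F_fun_le: "F_fun h u0 u x \<le> u0 * h j x + (\<Sum>i\<in>UNIV. u $ i * max 0 (h i x - h j x))"
  unfolding F_fun_def g_fun_def by (rule Min_le) auto

lemma F_fun_attained:
  obtains j where "F_fun h u0 u x = u0 * h j x + (\<Sum>i\<in>UNIV. u $ i * max 0 (h i x - h j x))"
proof -
  have "F_fun h u0 u x \<in> range (\<lambda>j. u0 * h j x + (\<Sum>i\<in>UNIV. u $ i * max 0 (h i x - h j x)))"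
    unfolding F_fun_def g_fun_def by (rule Min_in) auto
  then show ?thesis
    using that by blast
qed

text \<open>The function of \<open>c\<close> on the right is piecewise linear with breakpoints \<open>h i x\<close>, so moving \<open>c\<close>
  in a direction of descent ends at a breakpoint; \<open>1 \<le> \<Sum>i. u $ i\<close> excludes escape to \<open>-\<infinity>\<close>.\<close>

lemma F_fun_le_all:
  fixes u :: "real ^ 'n::finite"
  assumes u: "\<And>i. u $ i \<ge> 0" and sum: "(\<Sum>i\<in>UNIV. u $ i) \<ge> 1"
  shows "F_fun h 1 u x \<le> c + (\<Sum>i\<in>UNIV. u $ i * max 0 (h i x - c))"
proof -
  define P where "P = {i. h i x > c}"
  let ?s = "\<Sum>i\<in>P. u $ i"
  \<comment> \<open>The slope just above \<open>c\<close> is \<open>1 - ?s\<close>. If it is at most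
    0, \<open>j\<close> is the next breakpoint above; otherwise it is the nearest one at or below
    \<open>c\<close>. The product is the resulting decrease in value.\<close>
  have "\<exists>j. (\<forall>i\<in>P. h j x \<le> h i x) \<and> (\<forall>i. i \<notin> P \<longrightarrow> h i x \<le> h j x) \<and> (c - h j x) * (1 - ?s) \<ge> 0"
  proof (cases "?s \<ge> 1")
    case True
    then have "P \<noteq> {}"
      by auto
    then obtain j where j: "j \<in> P" "\<forall>i\<in>P. h j x \<le> h i x"
      using ex_is_arg_min_if_finite[of P "\<lambda>i. h i x"] by (force simp: is_arg_min_linorder)
    moreover have "h i x \<le> h j x" if "i \<notin> P" for i
      using that j(1) by (auto simp: P_def)
    moreover have "(c - h j x) * (1 - ?s) \<ge> 0"
      using j(1) True by (intro mult_nonpos_nonpos) (auto simp: P_def)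
    ultimately show ?thesis
      by blast
  next
    case False
    then have "- P \<noteq> {}"
      using sum by (metis compl_bot_eq double_complement)
    then obtain j where j: "j \<notin> P" "\<forall>i. i \<notin> P \<longrightarrow> h i x \<le> h j x"
      using ex_is_arg_min_if_finite[of "- P" "\<lambda>i. - h i x"] by (force simp: is_arg_min_linorder)
    moreover have "h j x \<le> h i x" if "i \<in> P" for i
      using that j(1) by (auto simp: P_def)
    moreover have "(c - h j x) * (1 - ?s) \<ge> 0"
      using j(1) False by (intro mult_nonneg_nonneg) (auto simp: P_def)
    ultimately show ?thesis
      by blast
  qed
  then obtain j where j: "\<And>i. i \<in> P \<Longrightarrow> h j x \<le> h i x" "\<And>i. i \<notin> P \<Longrightarrow> h i x \<le> h j x"
    "(c - h j x) * (1 - ?s) \<ge> 0"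
    by blast
  have "h j x + (\<Sum>i\<in>UNIV. u $ i * max 0 (h i x - h j x)) \<le> c + (\<Sum>i\<in>UNIV. u $ i * max 0 (h i x - c))"
    using j(3) sum_pos_part_eq[of P "h j x" "\<lambda>i. h i x" u] sum_pos_part_eq[of P c "\<lambda>i. h i x" u] j(1,2)
    by (auto simp: P_def algebra_simps)
  then show ?thesis
    using F_fun_le[of h 1 u x j] by simp
qed

text \<open>A duality certificate: since the weights on \<open>P\<close> sum to 1, every candidate
  \<open>j\<close> costs at least \<open>\<Sum>i\<in>P. u $ i * h i x\<close>, a bound free of
  \<open>j\<close>, and the level \<open>c\<close> attains it.\<close>

lemma F_fun_eq_if_sum_1:
  fixes u :: "real ^ 'n::finite"
  assumes u: "\<And>i. u $ i \<ge> 0" and sum: "(\<Sum>i\<in>P. u $ i) = 1"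
    and c: "\<And>i. i \<in> P \<Longrightarrow> c \<le> h i x" "\<And>i. i \<notin> P \<Longrightarrow> h i x \<le> c"
  shows "F_fun h 1 u x = c + (\<Sum>i\<in>UNIV. u $ i * max 0 (h i x - c))"
proof (rule antisym)
  have "(\<Sum>i\<in>P. u $ i) \<le> (\<Sum>i\<in>UNIV. u $ i)"
    using u by (intro sum_mono2) auto
  then show "F_fun h 1 u x \<le> c + (\<Sum>i\<in>UNIV. u $ i * max 0 (h i x - c))"
    using sum by (intro F_fun_le_all u) simp
  obtain j where j: "F_fun h 1 u x = 1 * h j x + (\<Sum>i\<in>UNIV. u $ i * max 0 (h i x - h j x))"
    by (rule F_fun_attained)
  have "(\<Sum>i\<in>P. u $ i * (h i x - h j x)) \<le> (\<Sum>i\<in>P. u $ i * max 0 (h i x - h j x))"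
    using u by (intro sum_mono mult_left_mono) auto
  also have "\<dots> \<le> (\<Sum>i\<in>UNIV. u $ i * max 0 (h i x - h j x))"
    using u by (intro sum_mono2) auto
  finally have "(\<Sum>i\<in>P. u $ i * h i x) \<le> F_fun h 1 u x"
    using sum j by (simp add: right_diff_distrib sum_subtractf flip: sum_distrib_right)
  then show "c + (\<Sum>i\<in>UNIV. u $ i * max 0 (h i x - c)) \<le> F_fun h 1 u x"
    using sum_pos_part_eq[of P c "\<lambda>i. h i x" u] c sum by simp
qed

lemma F_fun_le_P_H:
  fixes u :: "real ^ 'n::finite"
  assumes u: "\<And>i. u $ i \<ge> 0" and sum: "(\<Sum>i\<in>UNIV. u $ i) \<ge> 1"
    and y: "\<And>i. y $ i \<ge> 0" "\<And>i. w \<ge> h i x - y $ i"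
  shows "F_fun h 1 u x \<le> w + u \<bullet> y"
proof -
  have "(\<Sum>i\<in>UNIV. u $ i * max 0 (h i x - w)) \<le> (\<Sum>i\<in>UNIV. u $ i * y $ i)"
    using u y by (intro sum_mono mult_left_mono) (auto simp: algebra_simps)
  then show ?thesis
    using F_fun_le_all[OF u sum, of h x w] by (simp add: inner_vec_def)
qed

section \<open>Linear algebra for counting tight points\<close>

text \<open>The single vector \<open>v\<close> adds at most one dimension, so \<open>Z\<close> has
  affine dimension at least \<open>DIM('a) - 1\<close>. An affine basis of \<open>Z\<close> may have
  one point too many, hence the passage to a subset.\<close>

lemma card_affine_independent_subset:
  fixes Z :: "'a::euclidean_space set"
  assumes z0: "z0 \<in> Z" and span: "span (insert v ((\<lambda>z. z - z0) ` Z)) = UNIV"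
  shows "\<exists>T\<subseteq>Z. card T = DIM('a) \<and> \<not> affine_dependent T"
proof -
  let ?D = "(\<lambda>z. z - z0) ` Z"
  have "dim (insert v ?D) = DIM('a)"
    by (metis dim_UNIV dim_span span)
  then have "DIM('a) \<le> dim ?D + 1"
    by (simp add: dim_insert split: if_splits)
  moreover have "aff_dim Z = int (dim ?D)"
    using aff_dim_eq_dim[of z0 Z] hull_inc[OF z0] by simp
  moreover obtain B where B: "B \<subseteq> Z" "\<not> affine_dependent B" "affine hull Z = affine hull B"
    using affine_basis_exists by blast
  moreover have "of_nat (card B) = aff_dim Z + 1"
    using B by (intro aff_dim_unique) auto
  ultimately have "DIM('a) \<le> card B"
    by linarith
  then obtain T where "T \<subseteq> B" "card T = DIM('a)"
    by (metis obtain_subset_with_card_n)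
  then show ?thesis
    using B affine_independent_subset by (metis subset_trans)
qed

lemma subspace_contains_axes:
  fixes S :: "(real ^ 'n) set"
  assumes S: "subspace S" and ax: "\<And>i. axis i 1 \<in> S"
  shows "y \<in> S"
proof -
  have "(\<Sum>i\<in>UNIV. (y $ i) *\<^sub>R axis i 1) \<in> S"
    using S ax by (intro subspace_sum subspace_scale)
  then show ?thesis
    using basis_expansion[of y] by (simp add: scalar_mult_eq_scaleR)
qed

text \<open>Row \<open>r\<close> of \<open>B (B^-1 1) = 1\<close>; it makes the weights on the
  support of a 0-1 row sum to 1.\<close>

lemma sum_row_matrix_inv_on:
  assumes "invertible_on R C B" "finite R" "r \<in> R"
  shows "(\<Sum>c\<in>C. B r c * (\<Sum>r'\<in>R. matrix_inv_on R C B c r')) = 1"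
proof -
  have "inverse_pair_on R C B (matrix_inv_on R C B)"
    using assms(1) unfolding invertible_on_def matrix_inv_on_def by (rule someI_ex)
  then have "(\<Sum>r'\<in>R. \<Sum>c\<in>C. B r c * matrix_inv_on R C B c r') = (\<Sum>r'\<in>R. if r = r' then 1 else 0)"
    using assms(3) unfolding inverse_pair_on_def by (intro sum.cong) auto
  then show ?thesis
    using assms(2,3) by (simp add: sum_distrib_left sum.swap[of _ R])
qed


section \<open>From tight rows to a facet\<close>

text \<open>Only two traits of the matrix enter: each row is the indicator of a weight-1 set
  separated by a gap \<open>c0 < c1\<close> at a chain point, and the rows span the axes with
  \<open>u $ i \<noteq> 0\<close>.\<close>

lemma facet_defining_from_tight_rows:
  fixes X :: "(int ^ 'n::finite) set"
    and \<delta> :: "nat \<Rightarrow> 'n" and u :: "real ^ 'n" and row :: "'k \<Rightarrow> real ^ 'n"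
  assumes X_eq: "X = hyperrect a b" and box: "unit_box p \<subseteq> X"
    and perm: "bij_betw \<delta> {1..CARD('n)} UNIV"
    and u_nonneg: "\<And>i. u $ i \<ge> 0" and u_sum: "(\<Sum>i\<in>UNIV. u $ i) \<ge> 1"
    and F_Lnat: "Lnat_convex_on X (F_fun h 1 u)"
    and rows: "\<And>k. k \<in> R \<Longrightarrow> \<exists>x P c0 c1. x \<in> chain_pt p \<delta> ` {..CARD('n)} \<and> (\<Sum>i\<in>P. u $ i) = 1 \<and> c0 < c1 \<and>
        (\<forall>i\<in>P. c1 \<le> h i x) \<and> (\<forall>i. i \<notin> P \<longrightarrow> h i x \<le> c0) \<and> row k = (\<chi> i. if i \<in> P then 1 else 0)"
    and span_rows: "\<And>i. u $ i \<noteq> 0 \<Longrightarrow> axis i 1 \<in> span (row ` R)"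
  shows "facet_defining
           (\<lambda>(w, y, x). w + u \<bullet> y)
           (\<lambda>(w, y, x). misepi_rhs h p \<delta> 1 u x)
           (convex hull (P_H X h))"
proof -
  let ?F = "F_fun h 1 u"
  let ?lhs = "\<lambda>(w, y, x::real^'n). w + u \<bullet> y" and ?rhs = "\<lambda>(w::real, y::real^'n, x). misepi_rhs h p \<delta> 1 u x"
  define Z where "Z = {z \<in> convex hull (P_H X h). ?lhs z = ?rhs z}"
  have chain_X: "chain_pt p \<delta> k \<in> X" if "k \<le> CARD('n)" for k
    using chain_pt_in_unit_box[OF perm that] box by blast
  have valid: "?rhs z \<le> ?lhs z" if "z \<in> convex hull (P_H X h)" for z
  proof -
    have "convex {z. ?rhs z \<le> ?lhs z}"
      unfolding convex_def
    proof (clarsimp, goal_cases)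
      case (1 w y x w' y' x' s t)
      have "s * misepi_rhs h p \<delta> 1 u x + t * misepi_rhs h p \<delta> 1 u x' \<le> s * (w + u \<bullet> y) + t * (w' + u \<bullet> y')"
        using 1 by (intro add_mono mult_left_mono) auto
      then show ?case
        using 1 by (simp add: misepi_rhs_eq_chain_interp chain_interp_affine inner_add_right algebra_simps)
    qed
    moreover have "P_H X h \<subseteq> {z. ?rhs z \<le> ?lhs z}"
    proof
      fix z assume "z \<in> P_H X h"
      then obtain w y x where z: "z = (w, y, real_vec x)" and x: "x \<in> X"
        and y: "\<And>i. y $ i \<ge> 0" "\<And>i. w \<ge> h i x - y $ i"
        by (auto simp: P_H_def)
      have "chain_interp p \<delta> ?F (real_vec x) \<le> ?F x"
        using Lnat_convex_on_ge_chain_interp[OF perm] box F_Lnat x unfolding X_eq by blast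
      also have "\<dots> \<le> w + u \<bullet> y"
        using F_fun_le_P_H u_nonneg u_sum y by blast
      finally show "z \<in> {z. ?rhs z \<le> ?lhs z}"
        by (simp add: z misepi_rhs_eq_chain_interp)
    qed
    ultimately have "convex hull (P_H X h) \<subseteq> {z. ?rhs z \<le> ?lhs z}"
      by (intro hull_minimal)
    then show ?thesis
      using that by blast
  qed
  have in_P: "(w, y, real_vec (chain_pt p \<delta> k)) \<in> convex hull (P_H X h)"
    if "k \<le> CARD('n)" "\<And>i. y $ i \<ge> 0" "\<And>i. w \<ge> h i (chain_pt p \<delta> k) - y $ i" for w y k
    using that chain_X by (intro hull_inc) (auto simp: P_H_def)
  have in_Z: "(w, y, real_vec (chain_pt p \<delta> k)) \<in> Z"
    if "k \<le> CARD('n)" "\<And>i. y $ i \<ge> 0" "\<And>i. w \<ge> h i (chain_pt p \<delta> k) - y $ i"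
      "w + u \<bullet> y = ?F (chain_pt p \<delta> k)" for w y k
    using in_P[OF that(1-3)] that(4)
    by (simp add: Z_def misepi_rhs_eq_chain_interp chain_interp_chain_pt[OF perm that(1)])
  \<comment> \<open>This \<open>y\<close> is the least admissible one for \<open>w = c\<close>, so a
    minimising level \<open>c\<close> gives a tight point.\<close>
  have in_Z_level: "(c, (\<chi> i. max 0 (h i (chain_pt p \<delta> k) - c)), real_vec (chain_pt p \<delta> k)) \<in> Z"
    if "k \<le> CARD('n)" "?F (chain_pt p \<delta> k) = c + (\<Sum>i\<in>UNIV. u $ i * max 0 (h i (chain_pt p \<delta> k) - c))" for c k
    using that by (intro in_Z) (auto simp: inner_vec_def)
  have base: "\<exists>c. (c, (\<chi> i. max 0 (h i (chain_pt p \<delta> k) - c)), real_vec (chain_pt p \<delta> k)) \<in> Z"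
    if "k \<le> CARD('n)" for k
    using F_fun_attained[of h 1 u "chain_pt p \<delta> k"] in_Z_level[OF that] by auto
  let ?x0 = "chain_pt p \<delta> 0"
  obtain c where c: "(c, (\<chi> i. max 0 (h i ?x0 - c)), real_vec ?x0) \<in> Z"
    using base[of 0] by auto
  define y0 :: "real ^ 'n" where "y0 = (\<chi> i. max 0 (h i ?x0 - c))"
  have z0: "(c, y0, real_vec ?x0) \<in> Z"
    using c by (simp add: y0_def)
  define W where "W = span (insert (1, 0, 0) ((\<lambda>z. z - (c, y0, real_vec ?x0)) ` Z))"
  have W: "subspace W"
    by (simp add: W_def)
  have diff_W: "z - z' \<in> W" if "z \<in> Z" "z' \<in> Z" for z z'
  proof -
    have "(z - (c, y0, real_vec ?x0)) - (z' - (c, y0, real_vec ?x0)) \<in> W"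
      unfolding W_def using that by (intro span_diff span_base) auto
    then show ?thesis
      by simp
  qed
  \<comment> \<open>With the transversal direction in \<open>W\<close>, any
    \<open>w\<close>-component can be removed, so \<open>y\<close> and \<open>x\<close> directions
    can be treated separately.\<close>
  have w_W: "(t, 0, 0) \<in> W" for t
  proof -
    have "t *\<^sub>R (1, 0, 0) \<in> W"
      unfolding W_def by (intro span_scale span_base) auto
    then show ?thesis
      by simp
  qed
  define Y where "Y = {y. (0, y, 0) \<in> W}"
  have Y: "subspace Y"
    unfolding Y_def using subspace_0[OF W] subspace_add[OF W] subspace_scale[OF W]
    by (fastforce simp: subspace_def zero_prod_def)
  define V where "V = {x. (0, 0, x) \<in> W}"
  have V: "subspace V"
    unfolding V_def using subspace_0[OF W] subspace_add[OF W] subspace_scale[OF W]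
    by (fastforce simp: subspace_def zero_prod_def)
  have row_Y: "row k \<in> Y" if k: "k \<in> R" for k
  proof -
    obtain q P c0 c1 where q: "q \<le> CARD('n)" and P: "(\<Sum>i\<in>P. u $ i) = 1" "c0 < c1"
      and c1: "\<forall>i\<in>P. c1 \<le> h i (chain_pt p \<delta> q)"
      and c0: "\<forall>i. i \<notin> P \<longrightarrow> h i (chain_pt p \<delta> q) \<le> c0"
      and row: "row k = (\<chi> i. if i \<in> P then 1 else 0)"
      using rows[OF k] by blast
    let ?x = "chain_pt p \<delta> q"
    let ?z = "\<lambda>c. (c, (\<chi> i. max 0 (h i ?x - c)), real_vec ?x)"
    have "?z c \<in> Z" if "c \<in> {c0, c1}" for c
      using that c0 c1 P by (intro in_Z_level F_fun_eq_if_sum_1 q u_nonneg) force+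
    then have "?z c0 - ?z c1 \<in> W"
      by (intro diff_W) auto
    \<comment> \<open>On \<open>P\<close> both positive parts are linear and differ by
      \<open>c1 - c0\<close>; outside \<open>P\<close> both vanish.\<close>
    moreover have "(\<chi> i. max 0 (h i ?x - c0)) - (\<chi> i. max 0 (h i ?x - c1)) = (c1 - c0) *\<^sub>R row k"
      using c0 c1 P(2) by (force simp: row vec_eq_iff max_def)
    ultimately have "(c0 - c1, (c1 - c0) *\<^sub>R row k, 0) - (c0 - c1, 0, 0) \<in> W"
      by (intro subspace_diff[OF W] w_W) auto
    then have "(c1 - c0) *\<^sub>R row k \<in> Y"
      by (simp add: Y_def)
    then have "(1 / (c1 - c0)) *\<^sub>R (c1 - c0) *\<^sub>R row k \<in> Y"
      by (rule subspace_scale[OF Y])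
    then show ?thesis
      using P(2) by simp
  qed
  have y_W: "(0, y, 0) \<in> W" for y
  proof -
    have "axis i 1 \<in> Y" for i
    proof (cases "u $ i = 0")
      case True
      \<comment> \<open>Raising a coordinate of weight 0 stays feasible and costs nothing.\<close>
      have "(c, y0 + axis i 1, real_vec ?x0) \<in> Z"
      proof (rule in_Z)
        have ax: "axis i (1::real) $ j \<ge> 0" for j
          by (simp add: axis_def)
        show "(y0 + axis i 1) $ j \<ge> 0" for j
          using ax[of j] by (simp add: y0_def)
        show "c \<ge> h j ?x0 - (y0 + axis i 1) $ j" for j
          using ax[of j] by (simp add: y0_def max_def)
        have "c + u \<bullet> y0 = ?F ?x0"
          using z0 by (simp add: Z_def misepi_rhs_eq_chain_interp chain_interp_chain_pt[OF perm])
        then show "c + u \<bullet> (y0 + axis i 1) = ?F ?x0"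
          using True by (simp add: inner_add_right inner_axis)
      qed simp
      from diff_W[OF this z0] show ?thesis
        by (simp add: Y_def)
    next
      case False
      moreover have "span (row ` R) \<subseteq> Y"
        using row_Y Y by (intro span_minimal) auto
      ultimately show ?thesis
        using span_rows by blast
    qed
    then have "y \<in> Y"
      by (rule subspace_contains_axes[OF Y])
    then show ?thesis
      by (simp add: Y_def)
  qed
  have x_W: "(0, 0, x) \<in> W" for x
  proof -
    have "axis i 1 \<in> V" for i
    proof -
      obtain j where "j \<in> {1..CARD('n)}" "i = \<delta> j"
        using perm by (metis UNIV_I bij_betw_iff_bijections)
      then obtain k where k: "Suc k \<le> CARD('n)" "i = \<delta> (Suc k)"
        by (cases j) auto
      have step: "real_vec (chain_pt p \<delta> (Suc k)) - real_vec (chain_pt p \<delta> k) = axis i 1"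
        by (simp add: k(2) chain_pt_def real_vec_def vec_eq_iff axis_def)
      obtain w y w' y' where z: "(w, y, real_vec (chain_pt p \<delta> (Suc k))) \<in> Z"
        "(w', y', real_vec (chain_pt p \<delta> k)) \<in> Z"
        using base[of k] base[of "Suc k"] k(1) by auto
      then have "(w - w', y - y', axis i 1) - (w - w', 0, 0) - (0, y - y', 0) \<in> W"
        using diff_W[OF z] step by (intro subspace_diff[OF W] w_W y_W) simp
      then show ?thesis
        by (simp add: V_def)
    qed
    then have "x \<in> V"
      by (rule subspace_contains_axes[OF V])
    then show ?thesis
      by (simp add: V_def)
  qed
  have "W = UNIV"
  proof -
    have "(w, y, x) \<in> W" for w y x
      using subspace_add[OF W subspace_add[OF W w_W[of w] y_W[of y]] x_W[of x]] by simp
    then show ?thesis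
      by (metis UNIV_eq_I prod_cases3)
  qed
  then obtain T where T: "T \<subseteq> Z" "card T = DIM(real \<times> (real ^ 'n) \<times> (real ^ 'n))" "\<not> affine_dependent T"
    using card_affine_independent_subset[OF z0] unfolding W_def by blast
  \<comment> \<open>Raising \<open>w\<close> by 1 at a tight point keeps feasibility and leaves the
    hyperplane.\<close>
  have "(c + 1, y0, real_vec ?x0) \<in> convex hull (P_H X h)"
    by (rule in_P) (auto simp: y0_def)
  moreover have "?lhs (c + 1, y0, real_vec ?x0) \<noteq> ?rhs (c + 1, y0, real_vec ?x0)"
    using z0 by (simp add: Z_def)
  ultimately show ?thesis
    unfolding facet_defining_def using valid T unfolding Z_def by blast
qed

section \<open>The matrix conditions supply tight rows\<close>

theorem proposition5p29:
  fixes a b :: "'n::finite \<Rightarrow> int extended"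
    and X :: "(int ^ 'n) set"
    and h :: "'n \<Rightarrow> int ^ 'n \<Rightarrow> real"
    and p :: "int ^ 'n"
    and \<delta> :: "nat \<Rightarrow> 'n"
    and \<sigma> :: "nat \<Rightarrow> nat \<Rightarrow> 'n"  \<comment> \<open>\<open>\<sigma> k j\<close> is the index $(j)^k$\<close>
    and l :: "nat \<Rightarrow> nat"
    and A :: "nat \<Rightarrow> 'n \<Rightarrow> real"
    and M :: "'n set"
    and R :: "nat set"  \<comment> \<open>the rows of the submatrix $B$ of $A$\<close>
    and u :: "real ^ 'n"
  assumes n_ge_2: "CARD('n) \<ge> 2"
    and lower: "\<forall>i. a i \<noteq> Pinf" and upper: "\<forall>i. b i \<noteq> Minf"
    and X_eq: "X = hyperrect a b"
    and h_Lnat: "\<forall>j. Lnat_convex_on X (h j)"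
    and g_Lnat: "\<forall>j i. Lnat_convex_on X (g_fun h j i)"
    and F_Lnat: "\<forall>(v0, v) \<in> U_set. Lnat_convex_on X (F_fun h v0 v)"
    and p_in: "p \<in> hyperrect_under a b" and box: "unit_box p \<subseteq> X"
    and perm: "bij_betw \<delta> {1..CARD('n)} UNIV"
    and distinct: "\<forall>k\<le>CARD('n). inj (\<lambda>i. h i (chain_pt p \<delta> k))"
    and order_bij: "\<forall>k\<le>CARD('n). bij_betw (\<sigma> k) {1..CARD('n)} UNIV"
    and order_decr: "\<forall>k\<le>CARD('n). \<forall>i\<in>{1..CARD('n)}. \<forall>j\<in>{1..CARD('n)}. i < j \<longrightarrow>
          h (\<sigma> k i) (chain_pt p \<delta> k) > h (\<sigma> k j) (chain_pt p \<delta> k)"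
    and l_range: "\<forall>k\<le>CARD('n). l k \<in> {1..CARD('n)}"
    and A_eq: "\<forall>k\<le>CARD('n). \<forall>j\<in>{1..CARD('n)}. A k (\<sigma> k j) = (if j \<le> l k then 1 else 0)"
    and M_eq: "M = {i. \<exists>k\<le>CARD('n). A k i \<noteq> 0}"
    and rows: "R \<subseteq> {0..CARD('n)}" "card R = card M"
    and B_inv: "invertible_on R M A"
    and B_pos: "\<forall>i\<in>M. (\<Sum>k\<in>R. matrix_inv_on R M A i k * 1) > 0"
    and u_M: "\<forall>i\<in>M. u $ i = (\<Sum>k\<in>R. matrix_inv_on R M A i k * 1)"
    and u_not_M: "\<forall>i. i \<notin> M \<longrightarrow> u $ i = 0"
  shows "facet_defining
           (\<lambda>(w, y, x). w + u \<bullet> y)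
           (\<lambda>(w, y, x). misepi_rhs h p \<delta> 1 u x)
           (convex hull (P_H X h))"
proof -
  let ?n = "CARD('n)"
  have finite_R: "finite R"
    using rows(1) finite_subset by blast
  have inv: "inverse_pair_on R M A (matrix_inv_on R M A)"
    using B_inv unfolding invertible_on_def matrix_inv_on_def by (rule someI_ex)
  have R_le: "k \<le> ?n" if "k \<in> R" for k
    using rows(1) that by auto
  have index: "\<exists>j\<in>{1..?n}. i = \<sigma> k j" if "k \<le> ?n" for k i
    using order_bij that by (metis UNIV_I bij_betw_iff_bijections)
  have A_01: "A k i = 0 \<or> A k i = 1" if "k \<le> ?n" for k i
    using index[OF that, of i] A_eq that by auto
  have A_not_M: "A k i = 0" if "k \<le> ?n" "i \<notin> M" for k i
    using that by (auto simp: M_eq)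
  have u_nonneg: "u $ i \<ge> 0" for i
    using B_pos u_M u_not_M by (cases "i \<in> M") (auto simp: less_imp_le)
  define P where "P k = {i. A k i = 1}" for k
  have P_sum: "(\<Sum>i\<in>P k. u $ i) = 1" if k: "k \<in> R" for k
  proof -
    have "(\<Sum>i\<in>P k. u $ i) = (\<Sum>i\<in>M. A k i * u $ i)"
      using A_01[OF R_le[OF k]] A_not_M[OF R_le[OF k]]
      by (intro sum.mono_neutral_cong_left) (force simp: P_def)+
    also have "\<dots> = (\<Sum>i\<in>M. A k i * (\<Sum>k\<in>R. matrix_inv_on R M A i k))"
      using u_M by simp
    also have "\<dots> = 1"
      by (rule sum_row_matrix_inv_on[OF B_inv finite_R k])
    finally show ?thesis .
  qed
  \<comment> \<open>As \<open>l 0 \<ge> 1\<close>, row 0 of \<open>A\<close> is nonzero, so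
    \<open>M\<close> and with it \<open>R\<close> is nonempty. One row of weight 1 then puts
    \<open>(1, u)\<close> into \<open>U_set\<close>.\<close>
  have "R \<noteq> {}"
  proof -
    have "A 0 (\<sigma> 0 1) = 1"
      using A_eq l_range n_ge_2 by auto
    then have "\<sigma> 0 1 \<in> M"
      by (force simp: M_eq)
    then show ?thesis
      using rows(2) by (metis card.empty card_0_eq empty_iff finite)
  qed
  then obtain k where "k \<in> R"
    by blast
  then have "1 \<le> (\<Sum>i\<in>UNIV. u $ i)"
    using P_sum[of k] u_nonneg sum_mono2[of UNIV "P k" "\<lambda>i. u $ i"] by simp
  moreover have "Lnat_convex_on X (F_fun h 1 u)"
    using F_Lnat u_nonneg calculation by (force simp: U_set_def)
  moreover have "\<exists>x P c0 c1. x \<in> chain_pt p \<delta> ` {..?n} \<and> (\<Sum>i\<in>P. u $ i) = 1 \<and> c0 < c1 \<and>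
        (\<forall>i\<in>P. c1 \<le> h i x) \<and> (\<forall>i. i \<notin> P \<longrightarrow> h i x \<le> c0) \<and>
        (\<chi> i. A k i) = (\<chi> i. if i \<in> P then 1 else 0)" if k: "k \<in> R" for k
  proof -
    note kn = R_le[OF k]
    let ?x = "chain_pt p \<delta> k"
    let ?h = "\<lambda>j. h (\<sigma> k j) ?x"
    have decr: "?h j < ?h i" if "i \<in> {1..?n}" "j \<in> {1..?n}" "i < j" for i j
      using order_decr kn that by blast
    have lk: "l k \<in> {1..?n}"
      using l_range kn by blast
    \<comment> \<open>The gap lies between the values ranked \<open>l k\<close> and
      \<open>Suc (l k)\<close>. If \<open>l k = ?n\<close>, nothing lies outside \<open>P k\<close>
      and any smaller number will do.\<close>
    define c0 where "c0 = (if l k < ?n then ?h (Suc (l k)) else ?h (l k) - 1)"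
    have P_iff: "\<sigma> k j \<in> P k \<longleftrightarrow> j \<le> l k" if "j \<in> {1..?n}" for j
      using A_eq kn that by (simp add: P_def)
    have "c0 < ?h (l k)"
      using decr[of "l k" "Suc (l k)"] lk by (auto simp: c0_def)
    moreover have "?h (l k) \<le> h i ?x" if "i \<in> P k" for i
    proof -
      obtain j where j: "j \<in> {1..?n}" "i = \<sigma> k j"
        using index[OF kn] by blast
      then have "j \<le> l k"
        using that P_iff by blast
      then show ?thesis
        using decr[OF j(1) lk] j(2) by (cases "j = l k") auto
    qed
    moreover have "h i ?x \<le> c0" if "i \<notin> P k" for i
    proof -
      obtain j where j: "j \<in> {1..?n}" "i = \<sigma> k j"
        using index[OF kn] by blast
      then have "l k < j"
        using that P_iff by (metis not_le)
      then show ?thesis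
        using decr[of "Suc (l k)" j] j lk by (cases "j = Suc (l k)") (auto simp: c0_def)
    qed
    moreover have "(\<chi> i. A k i) = (\<chi> i. if i \<in> P k then 1 else 0)"
      using A_01[OF kn] by (auto simp: vec_eq_iff P_def)
    ultimately show ?thesis
      using P_sum[OF k] kn by (intro exI[of _ ?x] exI[of _ "P k"] exI[of _ c0] exI[of _ "?h (l k)"]) auto
  qed
  moreover have "axis i 1 \<in> span ((\<lambda>k. \<chi> i. A k i) ` R)" if "u $ i \<noteq> 0" for i
  proof -
    have i: "i \<in> M"
      using that u_not_M by blast
    \<comment> \<open>Row \<open>i\<close> of the left inverse times \<open>A\<close> gives the unit
      vector on \<open>M\<close>; outside \<open>M\<close> the columns of \<open>A\<close>
      vanish.\<close>
    have "axis i 1 = (\<Sum>k\<in>R. matrix_inv_on R M A i k *\<^sub>R (\<chi> i. A k i))"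
      unfolding vec_eq_iff
    proof
      fix j
      show "axis i 1 $ j = (\<Sum>k\<in>R. matrix_inv_on R M A i k *\<^sub>R (\<chi> i. A k i)) $ j"
      proof (cases "j \<in> M")
        case True
        then show ?thesis
          using inv i by (auto simp: inverse_pair_on_def axis_def)
      next
        case False
        then show ?thesis
          using i A_not_M R_le by (auto simp: axis_def)
      qed
    qed
    then show ?thesis
      by (simp only:) (intro span_sum span_scale span_base imageI)
  qed
  ultimately show ?thesis
    using facet_defining_from_tight_rows[OF X_eq box perm u_nonneg,
      where R = R and row = "\<lambda>k. \<chi> i. A k i" and h = h] by blast
qed

end
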